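(* Let $a,b>0$, $\varepsilon>0$, $\gamma\in\mathbb{R}$ with $\gamma\ne 0$, let $u$ be a random variable following the gamma distribution with density $p(u)=\frac{1}{\Gamma(a)b^a}u^{a-1}\exp\left(-\frac{u}{b}\right)$, $u>0$, and let $X(u)=u^\gamma$. Let $g_\varepsilon(y)=\varepsilon^{-1}(e^{\varepsilon y}-1)$ (the case $\alpha=1$, i.e. the Kullback–Leibler divergence). Then, for $(\mu,t)\in\mathbb{R}\times(0,+\infty)$, $$\mathbb{E}\left[g_\varepsilon\left(\frac{X(u)-\mu}{t}\right)\right]=\frac1\varepsilon\left\{\int_0^{+\infty}\frac{1}{\Gamma(a)b^a}u^{a-1}\exp\left(-\frac{u}{b}+\varepsilon\frac{u^\gamma-\mu}{t}\right)du-1\right\},$$ and there is a pair $(\mu,t)\in\mathbb{R}\times(0,+\infty)$ such that the right-hand side exists (as a real value) only if $0<\gamma\le 1$. Similarly, for $(\mu,t)\in\mathbb{R}\times(0,+\infty)$, $$\mathbb{E}\left[g_\varepsilon\left(-\frac{X(u)-\mu}{t}\right)\right]=\frac1\varepsilon\left\{\int_0^{+\infty}\frac{1}{\Gamma(a)b^a}u^{a-1}\exp\left(-\frac{u}{b}-\varepsilon\frac{u^\gamma-\mu}{t}\right)du-1\right\},$$ and there is a pair $(\mu,t)\in\mathbb{R}\times(0,+\infty)$ such that the right-hand side exists (as a real value) for any $\gamma\in\mathbb{R}$, $\gamma\neq 0$.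
   Context: $\Gamma$ is the gamma function and $\mathbb{E}$ is expectation with respect to the gamma law of $u$. The Kullback–Leibler divergence is $f(x)=x\ln x-x+1$ for $x\ge 0$ (with $0\ln 0=0$) and $f(x)=+\infty$ for $x<0$; its convex conjugate is $g(y)=e^y-1$, and $g_\varepsilon(y)=\varepsilon^{-1}g(\varepsilon y)$. Expectations and integrals are allowed to take the value $+\infty$; "exists" means that the value is finite. *)

theory Defs
  imports "HOL-Probability.Probability"
begin

text \<open>Shape \<open>a\<close>, scale \<open>b\<close>, as a density on \<open>lborel\<close>.\<close>

definition gamma_density :: "real \<Rightarrow> real \<Rightarrow> real \<Rightarrow> real" where
  "gamma_density a b u =
     (if 0 < u then 1 / (Gamma a * b powr a) * u powr (a - 1) * exp (- u / b) else 0)"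

text \<open>
  Expectation with values in the extended reals. The Bochner integral cannot serve here, since it
  is \<open>0\<close> for functions that are not integrable. The difference is the usual value
  whenever at most one of the two parts is infinite, in particular whenever \<open>X\<close> is bounded
  below; \<open>\<infinity> - \<infinity>\<close> is \<open>\<infinity>\<close> in \<open>ereal\<close>.
\<close>

definition ext_expectation :: "'w measure \<Rightarrow> ('w \<Rightarrow> real) \<Rightarrow> ereal" where
  "ext_expectation M X =
     enn2ereal (\<integral>\<^sup>+ w. ennreal (X w) \<partial>M) - enn2ereal (\<integral>\<^sup>+ w. ennreal (- X w) \<partial>M)"

text \<open>The convex conjugate of the Kullback--Leibler divergence \<open>x ln x - x + 1\<close>.\<close>

definition kl_conj :: "real \<Rightarrow> real" where
  "kl_conj y = exp y - 1"

definition kl_conj_eps :: "real \<Rightarrow> real \<Rightarrow> real" where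
  "kl_conj_eps \<epsilon> y = kl_conj (\<epsilon> * y) / \<epsilon>"

end

theory Submission
  imports Defs "HOL-Real_Asymp.Real_Asymp"
begin

text \<open>
  Since the law of \<open>u\<close> has mass one, the expectation of \<open>(exp Y - 1) / \<epsilon>\<close> splits, so only
  the integral of \<open>exp Y\<close> against the gamma density matters. For the first sign, if \<open>\<gamma> < 0\<close> the factor
  \<open>exp (\<epsilon> v powr \<gamma> / t)\<close> makes the integrand exceed \<open>1 / v\<^sup>2\<close> near \<open>0\<close>, and if \<open>\<gamma> > 1\<close> it beats
  \<open>exp (- v / b)\<close> and the integrand exceeds \<open>1\<close> near infinity; both force divergence. For the second sign,
  \<open>\<mu> = 0\<close> and \<open>t = 1\<close> make the extra factor at most \<open>1\<close>.
\<close>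

text \<open>Since \<open>Z\<close> is nonnegative, the negative part of \<open>(Z - 1) / c\<close>
  is at most \<open>1 / c\<close>. Its integral is finite on a probability space, so the difference
  defining \<open>ext_expectation\<close> is never \<open>\<infinity> - \<infinity>\<close>, even
  when \<open>Z\<close> has infinite integral.\<close>

lemma (in prob_space) ext_expectation_minus_one_div:
  fixes Z :: "'a \<Rightarrow> real"
  assumes [measurable]: "Z \<in> borel_measurable M" and Z: "\<And>w. 0 \<le> Z w" and c: "0 < c"
  shows "ext_expectation M (\<lambda>w. (Z w - 1) / c) =
    ereal (1 / c) * (enn2ereal (\<integral>\<^sup>+ w. ennreal (Z w) \<partial>M) - 1)"
proof -
  define P where "P = (\<integral>\<^sup>+ w. ennreal ((Z w - 1) / c) \<partial>M)"
  define N where "N = (\<integral>\<^sup>+ w. ennreal (- ((Z w - 1) / c)) \<partial>M)"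
  define I where "I = (\<integral>\<^sup>+ w. ennreal (Z w) \<partial>M)"
  \<comment> \<open>Writing the splitting as an equality of sums avoids the truncated subtraction of
    \<open>ennreal\<close>. Pointwise it is x = x+ - x- rearranged with x = (Z - 1) / c; the sign of
    \<open>Z w - 1\<close> decides which part vanishes.\<close>
  have "P + ennreal (1 / c) = (\<integral>\<^sup>+ w. ennreal ((Z w - 1) / c) + ennreal (1 / c) \<partial>M)"
    unfolding P_def by (subst nn_integral_add) (auto simp: emeasure_space_1)
  also have "\<dots> = (\<integral>\<^sup>+ w. ennreal (1 / c) * ennreal (Z w) + ennreal (- ((Z w - 1) / c)) \<partial>M)"
  proof (rule nn_integral_cong)
    fix w
    show "ennreal ((Z w - 1) / c) + ennreal (1 / c) =
        ennreal (1 / c) * ennreal (Z w) + ennreal (- ((Z w - 1) / c))"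
    proof (cases "Z w \<ge> 1")
      case True
      have "ennreal (- ((Z w - 1) / c)) = 0"
        using True c by (intro ennreal_neg) simp
      moreover have "(Z w - 1) / c + 1 / c = 1 / c * Z w"
        by (simp add: diff_divide_distrib)
      moreover have "0 \<le> (Z w - 1) / c"
        using True c by simp
      ultimately show ?thesis
        using c Z[of w] by (simp flip: ennreal_mult' ennreal_plus)
    next
      case False
      have "ennreal ((Z w - 1) / c) = 0"
        using False c by (intro ennreal_neg) (simp add: divide_le_0_iff)
      moreover have "1 / c * Z w + - ((Z w - 1) / c) = 1 / c"
        by (simp add: diff_divide_distrib)
      moreover have "0 \<le> - ((Z w - 1) / c)"
        using False c by (simp add: divide_le_0_iff)
      ultimately show ?thesis
        using c Z[of w] by (simp flip: ennreal_mult' ennreal_plus del: minus_diff_eq)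
    qed
  qed
  also have "\<dots> = ennreal (1 / c) * I + N"
    unfolding I_def N_def by (subst nn_integral_add) (auto simp: nn_integral_cmult)
  finally have eq: "P + ennreal (1 / c) = ennreal (1 / c) * I + N" .
  have "N \<le> (\<integral>\<^sup>+ w. ennreal (1 / c) \<partial>M)"
    unfolding N_def using c Z by (intro nn_integral_mono ennreal_leI) (simp add: field_simps)
  then have "N \<le> ennreal (1 / c)"
    by (simp add: emeasure_space_1)
  then obtain n where n: "N = ennreal n" "0 \<le> n"
    by (metis ennreal_cases ennreal_neq_top top.extremum_unique)
  \<comment> \<open>A finite \<open>I\<close> makes \<open>P\<close> finite, and \<open>eq\<close>
    becomes an equation between reals. An infinite \<open>I\<close> forces \<open>P\<close> to be
    infinite because \<open>1 / c\<close> is finite, and both sides are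
    \<open>\<infinity>\<close>.\<close>
  have "enn2ereal P - enn2ereal N = ereal (1 / c) * (enn2ereal I - 1)"
  proof (cases I)
    case (real i)
    have "P + ennreal (1 / c) = ennreal (i / c + n)"
      using eq real n c by (simp flip: ennreal_mult' ennreal_plus)
    then obtain p where p: "P = ennreal p" "0 \<le> p"
      by (metis ennreal_add_eq_top ennreal_cases ennreal_neq_top)
    have "p + 1 / c = i / c + n"
      using \<open>P + ennreal (1 / c) = ennreal (i / c + n)\<close> p n real c
      by (simp flip: ennreal_plus)
    then show ?thesis
      using real n p c
      by (simp add: diff_divide_distrib one_ereal_def enn2ereal_ennreal)
  next
    case top
    have "P = \<infinity>"
      using eq top c by (simp add: ennreal_mult_top)
    then show ?thesis
      using top n c by (simp add: enn2ereal_ennreal one_ereal_def)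
  qed
  then show ?thesis
    by (simp add: ext_expectation_def P_def N_def I_def)
qed

text \<open>A change of variables to the law of \<open>u\<close>, with a general exponent
  \<open>h\<close> so that both signs are instances. The second equation also serves in the opposite
  direction: an integral over the half-line can be estimated on \<open>M\<close>, where the total
  mass is one.\<close>

lemma ext_expectation_exp_gamma:
  fixes h :: "real \<Rightarrow> real"
  assumes "prob_space M" and a: "0 < a" and \<epsilon>: "0 < \<epsilon>"
    and u: "distributed M lborel u (\<lambda>x. ennreal (gamma_density a b x))"
    and h[measurable]: "h \<in> borel_measurable borel"
  shows "ext_expectation M (\<lambda>w. (exp (h (u w)) - 1) / \<epsilon>) =
     ereal (1 / \<epsilon>) *
       (enn2ereal (\<integral>\<^sup>+ v \<in> {0<..}. ennreal (1 / (Gamma a * b powr a) * v powr (a - 1) *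
          exp (- v / b + h v)) \<partial>lborel) - 1)"
    and "(\<integral>\<^sup>+ w. ennreal (exp (h (u w))) \<partial>M) =
      (\<integral>\<^sup>+ v \<in> {0<..}. ennreal (1 / (Gamma a * b powr a) * v powr (a - 1) *
          exp (- v / b + h v)) \<partial>lborel)"
proof -
  interpret prob_space M by fact
  have [measurable]: "u \<in> borel_measurable M"
    using distributed_measurable[OF u] by simp
  have G: "0 < Gamma a"
    using a by (rule Gamma_real_pos)
  have "(\<integral>\<^sup>+ w. ennreal (exp (h (u w))) \<partial>M) =
      (\<integral>\<^sup>+ v. ennreal (gamma_density a b v) * ennreal (exp (h v)) \<partial>lborel)"
    by (rule distributed_nn_integral[OF u, symmetric]) simp
  also have "\<dots> = (\<integral>\<^sup>+ v \<in> {0<..}. ennreal (1 / (Gamma a * b powr a) * v powr (a - 1) *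
          exp (- v / b + h v)) \<partial>lborel)"
    using G by (intro nn_integral_cong)
      (simp add: gamma_density_def mult_exp_exp mult.assoc flip: ennreal_mult' split: split_indicator)
  finally show eq: "(\<integral>\<^sup>+ w. ennreal (exp (h (u w))) \<partial>M) =
      (\<integral>\<^sup>+ v \<in> {0<..}. ennreal (1 / (Gamma a * b powr a) * v powr (a - 1) *
          exp (- v / b + h v)) \<partial>lborel)" .
  show "ext_expectation M (\<lambda>w. (exp (h (u w)) - 1) / \<epsilon>) =
     ereal (1 / \<epsilon>) *
       (enn2ereal (\<integral>\<^sup>+ v \<in> {0<..}. ennreal (1 / (Gamma a * b powr a) * v powr (a - 1) *
          exp (- v / b + h v)) \<partial>lborel) - 1)"
    using \<epsilon> by (subst ext_expectation_minus_one_div) (auto simp: eq)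
qed

lemma nn_set_integral_ge_const:
  fixes f :: "real \<Rightarrow> real"
  assumes "A \<subseteq> B" and [measurable]: "A \<in> sets borel" and "\<And>v. v \<in> A \<Longrightarrow> c \<le> f v"
  shows "ennreal c * emeasure lborel A \<le> (\<integral>\<^sup>+ v \<in> B. ennreal (f v) \<partial>lborel)"
proof -
  have "ennreal c * emeasure lborel A = (\<integral>\<^sup>+ v. ennreal c * indicator A v \<partial>lborel)"
    by (simp add: nn_integral_cmult_indicator)
  also have "\<dots> \<le> (\<integral>\<^sup>+ v \<in> B. ennreal (f v) \<partial>lborel)"
    using assms by (intro nn_integral_mono) (auto intro!: ennreal_leI split: split_indicator)
  finally show ?thesis .
qed

lemma ennreal_eq_topI:
  fixes x :: ennreal
  assumes "\<And>n::nat. ennreal (real n) \<le> x"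
  shows "x = top"
  using assms ennreal_Ex_less_of_nat[of x]
  by (metis ennreal_of_nat_eq_real_of_nat infinity_ennreal_def leD top.not_eq_extremum)

text \<open>Eventually \<open>f\<close> is at least \<open>1\<close>, so an interval of length
  \<open>n\<close> far enough to the right contributes at least \<open>n\<close>.\<close>

lemma nn_set_integral_eq_top_at_top:
  fixes f :: "real \<Rightarrow> real"
  assumes "filterlim f at_top at_top"
  shows "(\<integral>\<^sup>+ v \<in> {0<..}. ennreal (f v) \<partial>lborel) = top"
proof -
  have "eventually (\<lambda>v. 1 \<le> f v) at_top"
    using assms by (simp add: filterlim_at_top)
  then obtain K where K: "\<And>v. K \<le> v \<Longrightarrow> 1 \<le> f v"
    by (auto simp: eventually_at_top_linorder)
  have "ennreal (real n) \<le> (\<integral>\<^sup>+ v \<in> {0<..}. ennreal (f v) \<partial>lborel)" for n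
  proof -
    \<comment> \<open>The maximum with \<open>1\<close> keeps the interval inside the open
      half-line.\<close>
    define L where "L = max K 1"
    show ?thesis
      using nn_set_integral_ge_const[of "{L..L + real n}" "{0<..}" 1 f] K
      by (simp add: L_def subset_iff)
  qed
  then show ?thesis
    by (rule ennreal_eq_topI)
qed

text \<open>On \<open>{d / 2..d}\<close> the bound \<open>1 / d\<^sup>2\<close> already contributes \<open>1 / (2 d)\<close>.\<close>

lemma nn_set_integral_eq_top_at_right_0:
  fixes f :: "real \<Rightarrow> real"
  assumes "filterlim (\<lambda>v. v\<^sup>2 * f v) at_top (at_right 0)"
  shows "(\<integral>\<^sup>+ v \<in> {0<..}. ennreal (f v) \<partial>lborel) = top"
proof -
  have "eventually (\<lambda>v. 1 \<le> v\<^sup>2 * f v) (at_right 0)"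
    using assms by (simp add: filterlim_at_top)
  then obtain \<delta> where \<delta>: "0 < \<delta>" "\<And>v. 0 < v \<Longrightarrow> v < \<delta> \<Longrightarrow> 1 \<le> v\<^sup>2 * f v"
    by (auto simp: eventually_at_right_field)
  have "ennreal (real n) \<le> (\<integral>\<^sup>+ v \<in> {0<..}. ennreal (f v) \<partial>lborel)" for n
  proof -
    \<comment> \<open>The first bound puts \<open>{d / 2..d}\<close> strictly below
      \<open>\<delta>\<close>; the second gives \<open>1 / (2 * d) \<ge> n + 1\<close>, where adding
      one keeps the denominator nonzero at \<open>n = 0\<close>.\<close>
    define d where "d = min (\<delta> / 2) (1 / (2 * (real n + 1)))"
    have d: "0 < d" "d < \<delta>" "d \<le> 1 / (2 * (real n + 1))"
      using \<delta>(1) by (auto simp: d_def)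
    have "1 / d\<^sup>2 \<le> f v" if v: "d / 2 \<le> v" "v \<le> d" for v
    proof -
      have "0 < v"
        using v d by linarith
      have "1 / d\<^sup>2 \<le> 1 / v\<^sup>2"
        using v \<open>0 < v\<close> by (intro divide_left_mono power_mono) auto
      also have "\<dots> \<le> f v"
        using \<delta>(2)[of v] v d \<open>0 < v\<close> by (simp add: field_simps)
      finally show ?thesis .
    qed
    then have "ennreal (1 / d\<^sup>2) * emeasure lborel {d / 2..d} \<le>
        (\<integral>\<^sup>+ v \<in> {0<..}. ennreal (f v) \<partial>lborel)"
      using d by (intro nn_set_integral_ge_const) auto
    moreover have "ennreal (1 / d\<^sup>2) * emeasure lborel {d / 2..d} = ennreal (1 / (2 * d))"
      using d by (simp add: power2_eq_square field_simps flip: ennreal_mult')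
    moreover have "real n \<le> 1 / (2 * d)"
      using d by (simp add: field_simps)
    ultimately show ?thesis
      by (metis ennreal_leI order_trans)
  qed
  then show ?thesis
    by (rule ennreal_eq_topI)
qed

text \<open>Only the sign of the normalising factor \<open>C\<close> matters for the two limits, and
  \<open>\<mu>\<close> merely contributes the positive constant factor
  \<open>exp (- \<epsilon> * \<mu> / t)\<close>. No power \<open>v powr (a - 1)\<close> can offset
  the exponential growth.\<close>

lemma gamma_exp_powr_integral_eq_top:
  fixes a b C \<epsilon> \<mu> t \<gamma> :: real
  assumes "0 < C" "0 < b" "0 < \<epsilon>" "0 < t" and \<gamma>: "\<gamma> < 0 \<or> 1 < \<gamma>"
  shows "(\<integral>\<^sup>+ v \<in> {0<..}. ennreal (C * v powr (a - 1) *
      exp (- v / b + \<epsilon> * ((v powr \<gamma> - \<mu>) / t))) \<partial>lborel) = top"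
  using \<gamma>
proof
  assume "\<gamma> < 0"
  then show ?thesis
    using assms by (intro nn_set_integral_eq_top_at_right_0) real_asymp
next
  assume "1 < \<gamma>"
  then show ?thesis
    using assms by (intro nn_set_integral_eq_top_at_top) real_asymp
qed

theorem proposition6:
  fixes M :: "'w measure" and u :: "'w \<Rightarrow> real" and a b \<epsilon> \<gamma> :: real
  assumes "prob_space M"
    and "a > 0" and "b > 0" and "\<epsilon> > 0" and "\<gamma> \<noteq> 0"
    and "distributed M lborel u (\<lambda>x. ennreal (gamma_density a b x))"
  shows
    "(let R = (\<lambda>\<mu> t. ereal (1 / \<epsilon>) *
          (enn2ereal (\<integral>\<^sup>+ v \<in> {0<..}. ennreal (1 / (Gamma a * b powr a) * v powr (a - 1) *
              exp (- v / b + \<epsilon> * ((v powr \<gamma> - \<mu>) / t))) \<partial>lborel) - 1))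
      in (\<forall>\<mu> t. t > 0 \<longrightarrow>
            ext_expectation M (\<lambda>w. kl_conj_eps \<epsilon> ((u w powr \<gamma> - \<mu>) / t)) = R \<mu> t) \<and>
         ((\<exists>\<mu> t. t > 0 \<and> \<bar>R \<mu> t\<bar> \<noteq> \<infinity>) \<longrightarrow> 0 < \<gamma> \<and> \<gamma> \<le> 1))
     \<and>
     (let R = (\<lambda>\<mu> t. ereal (1 / \<epsilon>) *
          (enn2ereal (\<integral>\<^sup>+ v \<in> {0<..}. ennreal (1 / (Gamma a * b powr a) * v powr (a - 1) *
              exp (- v / b - \<epsilon> * ((v powr \<gamma> - \<mu>) / t))) \<partial>lborel) - 1))
      in (\<forall>\<mu> t. t > 0 \<longrightarrow>
            ext_expectation M (\<lambda>w. kl_conj_eps \<epsilon> (- ((u w powr \<gamma> - \<mu>) / t))) = R \<mu> t) \<and>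
         (\<exists>\<mu> t. t > 0 \<and> \<bar>R \<mu> t\<bar> \<noteq> \<infinity>))"
proof -
  interpret prob_space M by fact
  note gamma = ext_expectation_exp_gamma[OF assms(1,2,4,6)]
  have C: "0 < 1 / (Gamma a * b powr a)"
    using assms by (simp add: Gamma_real_pos)
  have plus: "ext_expectation M (\<lambda>w. kl_conj_eps \<epsilon> ((u w powr \<gamma> - \<mu>) / t)) =
      ereal (1 / \<epsilon>) *
          (enn2ereal (\<integral>\<^sup>+ v \<in> {0<..}. ennreal (1 / (Gamma a * b powr a) * v powr (a - 1) *
              exp (- v / b + \<epsilon> * ((v powr \<gamma> - \<mu>) / t))) \<partial>lborel) - 1)" for \<mu> t
    unfolding kl_conj_eps_def kl_conj_def
    by (rule gamma(1)[of "\<lambda>v. \<epsilon> * ((v powr \<gamma> - \<mu>) / t)"]) measurable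
  have minus: "ext_expectation M (\<lambda>w. kl_conj_eps \<epsilon> (- ((u w powr \<gamma> - \<mu>) / t))) =
      ereal (1 / \<epsilon>) *
          (enn2ereal (\<integral>\<^sup>+ v \<in> {0<..}. ennreal (1 / (Gamma a * b powr a) * v powr (a - 1) *
              exp (- v / b - \<epsilon> * ((v powr \<gamma> - \<mu>) / t))) \<partial>lborel) - 1)" for \<mu> t
    using gamma(1)[of "\<lambda>v. - (\<epsilon> * ((v powr \<gamma> - \<mu>) / t))"]
    unfolding kl_conj_eps_def kl_conj_def by simp
  have infinite: "(\<integral>\<^sup>+ v \<in> {0<..}. ennreal (1 / (Gamma a * b powr a) * v powr (a - 1) *
              exp (- v / b + \<epsilon> * ((v powr \<gamma> - \<mu>) / t))) \<partial>lborel) = top"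
    if "t > 0" "\<not> (0 < \<gamma> \<and> \<gamma> \<le> 1)" for \<mu> t
    using that assms C by (intro gamma_exp_powr_integral_eq_top) auto
  \<comment> \<open>The integral at the witnesses \<open>\<mu> = 0\<close> and \<open>t = 1\<close>,
    left unsimplified so that it is literally the instance needed for the existence claim.\<close>
  define J where "J = (\<integral>\<^sup>+ v \<in> {0<..}. ennreal (1 / (Gamma a * b powr a) * v powr (a - 1) *
              exp (- v / b - \<epsilon> * ((v powr \<gamma> - 0) / 1))) \<partial>lborel)"
  \<comment> \<open>Back on \<open>M\<close> the integrand is at most \<open>1\<close>, since
    \<open>powr\<close> is nonnegative and \<open>\<epsilon>\<close> is positive.\<close>
  have "J = (\<integral>\<^sup>+ w. ennreal (exp (- (\<epsilon> * ((u w powr \<gamma> - 0) / 1)))) \<partial>M)"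
    using gamma(2)[of "\<lambda>v. - (\<epsilon> * ((v powr \<gamma> - 0) / 1))"] unfolding J_def by simp
  also have "\<dots> \<le> (\<integral>\<^sup>+ w. 1 \<partial>M)"
    using assms by (intro nn_integral_mono) simp
  finally have "J \<le> 1"
    by (simp add: emeasure_space_1)
  then obtain j where "J = ennreal j" "0 \<le> j"
    by (metis ennreal_cases ennreal_one_neq_top top.extremum_unique)
  then have "\<bar>ereal (1 / \<epsilon>) * (enn2ereal J - 1)\<bar> \<noteq> \<infinity>"
    by (simp add: enn2ereal_ennreal one_ereal_def)
  then have convergent_minus: "\<exists>\<mu> t. t > 0 \<and> \<bar>ereal (1 / \<epsilon>) *
          (enn2ereal (\<integral>\<^sup>+ v \<in> {0<..}. ennreal (1 / (Gamma a * b powr a) * v powr (a - 1) *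
              exp (- v / b - \<epsilon> * ((v powr \<gamma> - \<mu>) / t))) \<partial>lborel) - 1)\<bar> \<noteq> \<infinity>"
    unfolding J_def by (intro exI[of _ "0::real"] exI[of _ "1::real"] conjI zero_less_one)
  have convergent_plus: "0 < \<gamma> \<and> \<gamma> \<le> 1" if ex: "\<exists>\<mu> t. t > 0 \<and> \<bar>ereal (1 / \<epsilon>) *
          (enn2ereal (\<integral>\<^sup>+ v \<in> {0<..}. ennreal (1 / (Gamma a * b powr a) * v powr (a - 1) *
              exp (- v / b + \<epsilon> * ((v powr \<gamma> - \<mu>) / t))) \<partial>lborel) - 1)\<bar> \<noteq> \<infinity>"
  proof (rule ccontr)
    assume *: "\<not> (0 < \<gamma> \<and> \<gamma> \<le> 1)"
    obtain \<mu> t where t: "t > 0" and fin: "\<bar>ereal (1 / \<epsilon>) *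
          (enn2ereal (\<integral>\<^sup>+ v \<in> {0<..}. ennreal (1 / (Gamma a * b powr a) * v powr (a - 1) *
              exp (- v / b + \<epsilon> * ((v powr \<gamma> - \<mu>) / t))) \<partial>lborel) - 1)\<bar> \<noteq> \<infinity>"
      using ex by (elim exE conjE)
    \<comment> \<open>By \<open>infinite\<close> the integral is \<open>top\<close> at this very
      pair; subtracting \<open>1\<close> and scaling by the positive \<open>1 / \<epsilon>\<close>
      leaves \<open>\<infinity>\<close>, against \<open>fin\<close>.\<close>
    show False
      using fin assms(4) unfolding infinite[OF t *] by (simp add: one_ereal_def)
  qed
  show ?thesis
    unfolding Let_def
    by (intro conjI allI impI plus minus convergent_minus; drule convergent_plus; elim conjE; assumption)
qed

end
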